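(* Assume that, under model $M_j$ (true rank $k=j$), the top eigenvalues $\ell_1\ge\ell_2\ge\cdots$ of $X$ satisfy $\ell_i \to \psi_{\sigma}(\lambda_i)$ almost surely for $1 \le i \le j$ and $\ell_i \to 2\sigma$ almost surely for $j < i \le q$, where $\psi_\sigma(x)=x+\sigma^2/x$. Regardless of whether $\sigma$ is known or unknown, under the assumption that $q$ and the eigenvalues of $A$ are fixed (do not change with $N$), we have: (a) If $\gamma \le 2$, then almost surely, $\liminf_{N \to \infty} \hat{k}_{\gamma} \ge k$. (b) If $\gamma > 2$, then almost surely, $\limsup_{N \to \infty} \hat{k}_{\gamma} \le k$. (c) Further, if $\lambda_k > \lambda_{\gamma} := \psi_{\sigma}^{-1}(\sqrt{2\gamma}\sigma)$, then for $\gamma > 2$, $\liminf_{N \to \infty} \hat{k}_{\gamma} \ge k$. As a consequence, if $\lambda_k > \lambda_{\gamma}$ (and $\gamma>2$), then $\hat{k}_{\gamma}$ is strongly consistent for $k$, i.e. $\hat k_\gamma \to k$ almost surely.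
   Context: Spiked GOE model $X = A + \sigma G$, where $G$ is an $N\times N$ GOE matrix (symmetric, upper-diagonal entries i.i.d. $\mathcal N(0,1/N)$, diagonal entries i.i.d. $\mathcal N(0,2/N)$), and $A=\sum_{i=1}^k\lambda_i u_iu_i^\top$ is positive semi-definite of rank $k$ with $\lambda_1\ge\cdots\ge\lambda_k>\sigma$ (the BBP threshold). Let $\ell_1\ge\cdots\ge\ell_N$ be the eigenvalues of $X$. Candidate models $M_0,\dots,M_q$, where under $M_j$ the rank is $j$. $\psi_\sigma(x)=x+\sigma^2/x$, which is strictly increasing on $(\sigma,\infty)$ with $\psi_\sigma(\sigma)=2\sigma$. The generalised AIC scores are: for known $\sigma$, $\mathrm{GAIC}_\gamma(j) = -2\log C_N + \frac{N(N+1)}{2}\log\sigma^2 + \frac{N}{2\sigma^2}\sum_{i>j}\ell_i^2 + \gamma\big(Nj - \frac{j(j-1)}{2}\big)$; for unknown $\sigma$, with $\hat{\sigma}^2_j = \frac{1}{N+1}\sum_{i>j}\ell_i^2$, $\mathrm{GAIC}_\gamma(j) = -2\log C_N + \frac{N(N+1)}{2}\log\hat\sigma^2_j + \frac{N}{2\hat\sigma^2_j}\sum_{i>j}\ell_i^2 + \gamma\big(1+Nj - \frac{j(j-1)}{2}\big)$, where $C_N$ is the normalising constant of the GOE-type density. These are $-2\times$(maximised log-likelihood) $+\gamma\times$(number of parameters). The estimator $\hat k_\gamma$ is the minimiser of $\mathrm{GAIC}_\gamma(j)$ over $j\in\{0,1,\dots,q\}$. *)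

theory Defs
  imports "HOL-Probability.Probability" "Jordan_Normal_Form.Char_Poly"
begin

text \<open>Matrices of size N x N are represented as functions nat => nat => real,
  only the entries with indices < N being relevant.  Eigenvalues are 0-indexed:
  entry i of the list corresponds to the paper's eigenvalue l_(i+1).\<close>

definition to_mat :: "nat \<Rightarrow> (nat \<Rightarrow> nat \<Rightarrow> real) \<Rightarrow> real Matrix.mat" where
  "to_mat N X = Matrix.mat N N (\<lambda>(i,j). X i j)"

definition ordered_eigs :: "nat \<Rightarrow> (nat \<Rightarrow> nat \<Rightarrow> real) \<Rightarrow> real list" where
  "ordered_eigs N X = (THE ls. length ls = N \<and> sorted_wrt (\<ge>) ls \<and>
      char_poly (to_mat N X) = (\<Prod>x\<leftarrow>ls. [:- x, 1:]))"

definition spiked_X :: "nat \<Rightarrow> (nat \<Rightarrow> real) \<Rightarrow> (nat \<Rightarrow> nat \<Rightarrow> nat \<Rightarrow> real) \<Rightarrow> real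
    \<Rightarrow> (nat \<Rightarrow> 'a \<Rightarrow> nat \<Rightarrow> nat \<Rightarrow> real) \<Rightarrow> nat \<Rightarrow> 'a \<Rightarrow> nat \<Rightarrow> nat \<Rightarrow> real" where
  "spiked_X k lam u \<sigma> G N \<omega> i j = (\<Sum>r<k. lam r * u N r i * u N r j) + \<sigma> * G N \<omega> i j"

definition psi :: "real \<Rightarrow> real \<Rightarrow> real" where
  "psi \<sigma> x = x + \<sigma>\<^sup>2 / x"

definition psi_inv :: "real \<Rightarrow> real \<Rightarrow> real" where
  "psi_inv \<sigma> y = (THE x. \<sigma> < x \<and> psi \<sigma> x = y)"

definition lambda_gamma :: "real \<Rightarrow> real \<Rightarrow> real" where
  "lambda_gamma \<sigma> \<gamma> = psi_inv \<sigma> (sqrt (2 * \<gamma>) * \<sigma>)"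

text \<open>Normalising constant C_N of the GOE-type density
  f(X) = C_N sigma^(-N(N+1)/2) exp(-N/(4 sigma^2) tr (X-A)^2) of the N(N+1)/2 free entries.\<close>
definition goe_const :: "nat \<Rightarrow> real" where
  "goe_const N = (real N / (2 * pi)) powr (real N * (real N + 1) / 4) * 2 powr (- real N / 2)"

text \<open>GAIC with known sigma; ls is the non-increasing eigenvalue list of X.\<close>
definition gaic_known :: "nat \<Rightarrow> real \<Rightarrow> real \<Rightarrow> real list \<Rightarrow> nat \<Rightarrow> real" where
  "gaic_known N \<sigma> \<gamma> ls j =
     - 2 * ln (goe_const N) + real N * (real N + 1) / 2 * ln (\<sigma>\<^sup>2)
     + real N / (2 * \<sigma>\<^sup>2) * (\<Sum>i\<in>{j..<N}. (ls ! i)\<^sup>2)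
     + \<gamma> * (real N * real j - real j * (real j - 1) / 2)"

definition sigma_hat_sq :: "nat \<Rightarrow> real list \<Rightarrow> nat \<Rightarrow> real" where
  "sigma_hat_sq N ls j = 1 / (real N + 1) * (\<Sum>i\<in>{j..<N}. (ls ! i)\<^sup>2)"

text \<open>GAIC with unknown sigma (sigma replaced by its MLE under M_j).\<close>
definition gaic_unknown :: "nat \<Rightarrow> real \<Rightarrow> real list \<Rightarrow> nat \<Rightarrow> real" where
  "gaic_unknown N \<gamma> ls j =
     - 2 * ln (goe_const N) + real N * (real N + 1) / 2 * ln (sigma_hat_sq N ls j)
     + real N / (2 * sigma_hat_sq N ls j) * (\<Sum>i\<in>{j..<N}. (ls ! i)\<^sup>2)
     + \<gamma> * (1 + real N * real j - real j * (real j - 1) / 2)"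

definition argmin_upto :: "nat \<Rightarrow> (nat \<Rightarrow> real) \<Rightarrow> nat" where
  "argmin_upto q f = (LEAST j. j \<le> q \<and> (\<forall>i\<le>q. f j \<le> f i))"

definition khat :: "bool \<Rightarrow> nat \<Rightarrow> real \<Rightarrow> real \<Rightarrow> nat \<Rightarrow> real list \<Rightarrow> nat" where
  "khat known N \<sigma> \<gamma> q ls =
     (if known then argmin_upto q (gaic_known N \<sigma> \<gamma> ls)
      else argmin_upto q (gaic_unknown N \<gamma> ls))"

end

theory Submission
  imports Defs "Jordan_Normal_Form.Schur_Decomposition" "HOL-Real_Asymp.Real_Asymp"
begin

text \<open>On the scale \<open>N\<close>, raising the rank from \<open>i\<close> to \<open>i + 1\<close> changes the score by the penalty
  \<open>\<gamma>\<close> minus \<open>l\<^sub>i\<^sub>+\<^sub>1\<^sup>2 / (2 \<sigma>\<^sup>2)\<close>, so the rank is worth including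
  exactly when the limiting eigenvalue exceeds \<open>sqrt (2 \<gamma>) \<sigma>\<close>; the bulk edge \<open>2 \<sigma>\<close>
  corresponds to \<open>\<gamma> = 2\<close>. For unknown \<open>\<sigma>\<close> the same limit holds once the variance estimates
  tend to \<open>\<sigma>\<^sup>2\<close>. Their numerators are, up to finitely many bounded terms, the squared Frobenius
  norm of \<open>X\<close>; by Cauchy-Schwarz the spikes do not contribute to it at leading order, and the
  squared Frobenius norm of \<open>G\<close>, divided by its mean \<open>N + 1\<close>, has variance
  \<open>4 / (N (N + 1))\<close>. This is summable, so no coupling between different \<open>N\<close> is needed for
  almost sure convergence.\<close>

section \<open>Eigenvalues of real symmetric matrices\<close>

lemma trace_mult_commute:
  fixes A B :: "'a :: comm_semiring_1 Matrix.mat"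
  assumes "A \<in> carrier_mat n n" "B \<in> carrier_mat n n"
  shows "(\<Sum>i<n. (A * B) $$ (i, i)) = (\<Sum>i<n. (B * A) $$ (i, i))"
proof -
  have entry: "(P * Q) $$ (i, i) = (\<Sum>j<n. P $$ (i, j) * Q $$ (j, i))"
    if "P \<in> carrier_mat n n" "Q \<in> carrier_mat n n" "i < n" for P Q :: "'a Matrix.mat" and i
    using that by (simp add: scalar_prod_def atLeast0LessThan)
  have "(\<Sum>i<n. (A * B) $$ (i, i)) = (\<Sum>i<n. \<Sum>j<n. A $$ (i, j) * B $$ (j, i))"
    using assms by (intro sum.cong) (simp_all add: entry del: index_mult_mat(1))
  also have "\<dots> = (\<Sum>j<n. \<Sum>i<n. B $$ (j, i) * A $$ (i, j))"
    by (subst sum.swap) (simp add: mult.commute)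
  also have "\<dots> = (\<Sum>i<n. (B * A) $$ (i, i))"
    using assms by (intro sum.cong) (simp_all add: entry del: index_mult_mat(1))
  finally show ?thesis .
qed

text \<open>Schur triangularisation writes \<open>A\<close> as \<open>P * B * Q\<close> with
  \<open>Q\<close> inverse to \<open>P\<close> and the roots on the diagonal of \<open>B\<close>.
  Cyclicity of the trace then moves from \<open>A * A\<close> to \<open>B * B\<close>, whose
  diagonal consists of the squared roots.\<close>

lemma sum_list_squared_roots_char_poly:
  fixes A :: "real Matrix.mat"
  assumes A: "A \<in> carrier_mat n n"
    and cp: "char_poly A = (\<Prod>x\<leftarrow>ls. [:- x, 1:])"
  shows "(\<Sum>x\<leftarrow>ls. x\<^sup>2) = (\<Sum>i<n. (A * A) $$ (i, i))"
proof -
  obtain B P Q where dec: "schur_decomposition A ls = (B, P, Q)"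
    by (cases "schur_decomposition A ls") auto
  from schur_decomposition[OF A cp dec]
  have sim: "similar_mat_wit A B P Q" and ut: "upper_triangular B" and diag: "diag_mat B = ls"
    by auto
  from similar_mat_witD2[OF A sim]
  have PQ: "P * Q = 1\<^sub>m n" "Q * P = 1\<^sub>m n" and AB: "A = P * B * Q"
    and B: "B \<in> carrier_mat n n" and P: "P \<in> carrier_mat n n" and Q: "Q \<in> carrier_mat n n"
    by auto
  have "A * A = (P * B * Q) * (P * B * Q)"
    using AB by simp
  also have "\<dots> = P * B * (Q * P) * (B * Q)"
    using B P Q by (simp add: assoc_mult_mat[of _ n n _ n _ n])
  also have "\<dots> = (P * (B * B)) * Q"
    using B P Q by (simp add: PQ(2) assoc_mult_mat[of _ n n _ n _ n])
  finally have "(\<Sum>i<n. (A * A) $$ (i, i)) = (\<Sum>i<n. (Q * (P * (B * B))) $$ (i, i))"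
    using B P Q by (simp add: trace_mult_commute[of "P * (B * B)" n Q] del: index_mult_mat(1))
  also have "Q * (P * (B * B)) = (Q * P) * (B * B)"
    using B P Q by (simp add: assoc_mult_mat[of _ n n _ n _ n])
  also have "\<dots> = B * B"
    using B by (simp add: PQ(2))
  also have "(\<Sum>i<n. (B * B) $$ (i, i)) = (\<Sum>i<n. (B $$ (i, i))\<^sup>2)"
  proof (intro sum.cong refl)
    fix i assume "i \<in> {..<n}"
    then have i: "i < n" by simp
    have "(B * B) $$ (i, i) = (\<Sum>j<n. B $$ (i, j) * B $$ (j, i))"
      using B i by (simp add: scalar_prod_def atLeast0LessThan)
    \<comment> \<open>For \<open>j\<close> different from \<open>i\<close>, one of the two factors
      lies strictly below the diagonal of the triangular matrix \<open>B\<close>.\<close>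
    also have "\<dots> = (\<Sum>j\<in>{i}. B $$ (i, j) * B $$ (j, i))"
    proof (rule sum.mono_neutral_right)
      show "\<forall>j\<in>{..<n} - {i}. B $$ (i, j) * B $$ (j, i) = 0"
      proof
        fix j assume j: "j \<in> {..<n} - {i}"
        then consider "j < i" | "i < j" by fastforce
        then show "B $$ (i, j) * B $$ (j, i) = 0"
          using upper_triangularD[OF ut, of j i] upper_triangularD[OF ut, of i j] B i j
          by cases auto
      qed
    qed (use i in auto)
    finally show "(B * B) $$ (i, i) = (B $$ (i, i))\<^sup>2"
      by (simp add: power2_eq_square)
  qed
  also have "\<dots> = (\<Sum>x\<leftarrow>ls. x\<^sup>2)"
    using B diag[symmetric]
    by (simp add: diag_mat_def comp_def interv_sum_list_conv_sum_set_nat atLeast0LessThan)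
  finally show ?thesis by simp
qed

text \<open>The Hermitian form of \<open>A\<close> at an eigenvector is \<open>a\<close> times the
  squared norm of that vector. By symmetry the form is its own conjugate, and the norm is nonzero,
  so \<open>a\<close> is self-conjugate.\<close>

lemma complex_eigenvalue_real_symmetric:
  fixes A :: "real Matrix.mat"
  assumes A: "A \<in> carrier_mat n n"
    and sym: "\<And>i j. i < n \<Longrightarrow> j < n \<Longrightarrow> A $$ (i, j) = A $$ (j, i)"
    and ev: "eigenvalue (map_mat complex_of_real A) a"
  shows "a \<in> \<real>"
proof -
  let ?C = "map_mat complex_of_real A"
  from ev A obtain v where v: "v \<in> carrier_vec n" "v \<noteq> 0\<^sub>v n" "?C *\<^sub>v v = a \<cdot>\<^sub>v v"
    unfolding eigenvalue_def eigenvector_def by auto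
  have row: "(\<Sum>j<n. of_real (A $$ (i, j)) * vec_index v j) = a * vec_index v i" if "i < n" for i
  proof -
    have "vec_index (?C *\<^sub>v v) i = vec_index (a \<cdot>\<^sub>v v) i"
      using v by simp
    then show ?thesis
      using that A v(1) by (simp add: scalar_prod_def atLeast0LessThan)
  qed
  define S where "S = (\<Sum>i<n. \<Sum>j<n. cnj (vec_index v i) * (of_real (A $$ (i, j)) * vec_index v j))"
  define t where "t = (\<Sum>i<n. (cmod (vec_index v i))\<^sup>2)"
  have "S = (\<Sum>i<n. cnj (vec_index v i) * (a * vec_index v i))"
    unfolding S_def by (intro sum.cong) (simp_all add: row flip: sum_distrib_left)
  also have "\<dots> = a * of_real t"
    unfolding t_def of_real_sum sum_distrib_left
    by (intro sum.cong refl) (simp only: complex_norm_square, simp add: ac_simps)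
  finally have S: "S = a * of_real t" .
  have "cnj S = (\<Sum>i<n. \<Sum>j<n. vec_index v i * (of_real (A $$ (i, j)) * cnj (vec_index v j)))"
    by (simp add: S_def)
  also have "\<dots> = S"
    unfolding S_def
    by (subst sum.swap, intro sum.cong refl) (simp add: sym ac_simps)
  finally have "cnj a * of_real t = a * of_real t"
    by (simp add: S)
  moreover have "t \<noteq> 0"
  proof
    assume "t = 0"
    then have "\<forall>i<n. vec_index v i = 0"
      by (simp add: t_def sum_nonneg_eq_0_iff)
    then have "v = 0\<^sub>v n"
      using v(1) by (intro eq_vecI) auto
    with v(2) show False by simp
  qed
  ultimately show ?thesis
    by (simp add: Reals_cnj_iff)
qed

text \<open>The polynomial factors over the complex numbers, and all its roots there are real. The
  embedding of real into complex polynomials is injective, so the factorisation descends to the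
  reals.\<close>

lemma char_poly_real_symmetric_splits:
  fixes A :: "real Matrix.mat"
  assumes A: "A \<in> carrier_mat n n"
    and sym: "\<And>i j. i < n \<Longrightarrow> j < n \<Longrightarrow> A $$ (i, j) = A $$ (j, i)"
  shows "\<exists>ls. length ls = n \<and> char_poly A = (\<Prod>x\<leftarrow>ls. [:- x, 1:])"
proof -
  interpret of_real: map_poly_inj_comm_ring_hom complex_of_real ..
  let ?C = "map_mat complex_of_real A"
  have C: "?C \<in> carrier_mat n n"
    using A by simp
  obtain as where as: "char_poly ?C = (\<Prod>a\<leftarrow>as. [:- a, 1:])" "length as = n"
    using char_poly_factorized[OF C] by blast
  have re: "complex_of_real (Re a) = a" if "a \<in> set as" for a
  proof -
    have "poly (char_poly ?C) a = 0"
      using that by (force simp: as(1) poly_prod_list)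
    then have "eigenvalue ?C a"
      using eigenvalue_root_char_poly[OF C] by simp
    then show ?thesis
      using complex_eigenvalue_real_symmetric[OF A sym] by simp
  qed
  have "map_poly complex_of_real (\<Prod>x\<leftarrow>map Re as. [:- x, 1:]) = (\<Prod>a\<leftarrow>as. [:- a, 1:])"
    by (simp add: of_real.hom_prod_list comp_def map_poly_pCons re cong: map_cong)
  also have "\<dots> = map_poly complex_of_real (char_poly A)"
    by (rule trans[OF as(1)[symmetric] of_real_hom.char_poly_hom[OF A]])
  finally show ?thesis
    using as(2) by (intro exI[of _ "map Re as"]) simp
qed

text \<open>This makes the definite description in \<open>ordered_eigs\<close> meaningful. A product
  of monic linear factors determines the multiset of its roots, and a multiset of reals has exactly
  one non-increasing arrangement.\<close>

lemma ordered_eigs_unique: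
  assumes sym: "\<And>i j. X i j = X j i"
  shows "\<exists>!ls. length ls = N \<and> sorted_wrt (\<ge>) ls \<and>
    char_poly (to_mat N X) = (\<Prod>x\<leftarrow>ls. [:- x, 1:])"
proof -
  have A: "to_mat N X \<in> carrier_mat N N"
    by (simp add: to_mat_def)
  obtain ls where ls: "length ls = N" "char_poly (to_mat N X) = (\<Prod>x\<leftarrow>ls. [:- x, 1:])"
    using char_poly_real_symmetric_splits[OF A] sym by (auto simp: to_mat_def)
  have mset_prod: "(\<Prod>x\<leftarrow>xs. [:- x, 1:]) = (\<Prod>x\<in>#mset xs. [:- x, 1:])" for xs :: "real list"
    by (simp flip: prod_mset_prod_list)
  have mset_roots: "proots (\<Prod>x\<leftarrow>xs. [:- x, 1:]) = mset xs" for xs :: "real list"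
  proof (induction xs)
    case (Cons x xs)
    have "(\<Prod>x\<leftarrow>xs. [:- x, 1:]) \<noteq> 0"
      by (auto simp: prod_list_zero_iff)
    then show ?case
      using Cons by (simp add: proots_mult del: mult_pCons_left)
  qed simp
  have desc: "sorted_wrt (\<ge>) xs \<longleftrightarrow> sorted (rev xs)" for xs :: "real list"
    by (simp add: sorted_wrt_rev)
  show ?thesis
  proof (rule ex1I[of _ "rev (sort ls)"])
    show "length (rev (sort ls)) = N \<and> sorted_wrt (\<ge>) (rev (sort ls)) \<and>
        char_poly (to_mat N X) = (\<Prod>x\<leftarrow>rev (sort ls). [:- x, 1:])"
      using ls by (simp add: desc mset_prod del: prod_mset_prod_list)
  next
    fix xs assume xs: "length xs = N \<and> sorted_wrt (\<ge>) xs \<and>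
        char_poly (to_mat N X) = (\<Prod>x\<leftarrow>xs. [:- x, 1:])"
    then have "mset xs = mset ls"
      using mset_roots ls(2) by metis
    then have "sort ls = rev xs"
      using xs by (intro properties_for_sort) (simp_all add: desc)
    then show "xs = rev (sort ls)" by simp
  qed
qed

text \<open>This is the bridge from the spectrum to the matrix entries: the numerators of the
  variance estimates become Frobenius norms, whose randomness can be handled entry by entry.\<close>

lemma sum_ordered_eigs_squared:
  assumes sym: "\<And>i j. X i j = X j i"
  shows "(\<Sum>i<N. (ordered_eigs N X ! i)\<^sup>2) = (\<Sum>i<N. \<Sum>j<N. (X i j)\<^sup>2)"
proof -
  have A: "to_mat N X \<in> carrier_mat N N"
    by (simp add: to_mat_def)
  have "length (ordered_eigs N X) = N \<and> sorted_wrt (\<ge>) (ordered_eigs N X) \<and>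
      char_poly (to_mat N X) = (\<Prod>x\<leftarrow>ordered_eigs N X. [:- x, 1:])"
    unfolding ordered_eigs_def by (rule theI'[OF ordered_eigs_unique[OF sym]])
  then have len: "length (ordered_eigs N X) = N"
    and cp: "char_poly (to_mat N X) = (\<Prod>x\<leftarrow>ordered_eigs N X. [:- x, 1:])"
    by auto
  have "(\<Sum>i<N. (ordered_eigs N X ! i)\<^sup>2) = (\<Sum>x\<leftarrow>ordered_eigs N X. x\<^sup>2)"
    by (simp add: sum_list_sum_nth len atLeast0LessThan)
  also have "\<dots> = (\<Sum>i<N. (to_mat N X * to_mat N X) $$ (i, i))"
    by (rule sum_list_squared_roots_char_poly[OF A cp])
  also have "\<dots> = (\<Sum>i<N. \<Sum>j<N. (X i j)\<^sup>2)"
    by (intro sum.cong refl)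
      (simp add: to_mat_def scalar_prod_def atLeast0LessThan power2_eq_square sym)
  finally show ?thesis .
qed

section \<open>The Frobenius norm of a GOE matrix\<close>

text \<open>Expanding the square, each mixed product has expectation zero by independence and
  centring, so only the diagonal terms remain.\<close>

lemma (in prob_space) expectation_square_sum_indep:
  fixes X :: "'i \<Rightarrow> 'a \<Rightarrow> real"
  assumes fin: "finite I"
    and indep: "indep_vars (\<lambda>_. borel) X I"
    and int: "\<And>i. i \<in> I \<Longrightarrow> integrable M (X i)"
    and int2: "\<And>i. i \<in> I \<Longrightarrow> integrable M (\<lambda>\<omega>. (X i \<omega>)\<^sup>2)"
    and mean: "\<And>i. i \<in> I \<Longrightarrow> expectation (X i) = 0"
  shows "integrable M (\<lambda>\<omega>. (\<Sum>i\<in>I. X i \<omega>)\<^sup>2)"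
    and "expectation (\<lambda>\<omega>. (\<Sum>i\<in>I. X i \<omega>)\<^sup>2) = (\<Sum>i\<in>I. expectation (\<lambda>\<omega>. (X i \<omega>)\<^sup>2))"
proof -
  have prod: "integrable M (\<lambda>\<omega>. X i \<omega> * X j \<omega>)"
    "expectation (\<lambda>\<omega>. X i \<omega> * X j \<omega>) = (if i = j then expectation (\<lambda>\<omega>. (X i \<omega>)\<^sup>2) else 0)"
    if ij: "i \<in> I" "j \<in> I" for i j
  proof -
    have "integrable M (\<lambda>\<omega>. X i \<omega> * X j \<omega>) \<and> expectation (\<lambda>\<omega>. X i \<omega> * X j \<omega>) = 0" if "i \<noteq> j"
    proof -
      have sub: "indep_vars (\<lambda>_. borel) X {i, j}"
        using indep ij by (rule_tac indep_vars_subset) auto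
      have "integrable M (\<lambda>\<omega>. \<Prod>l\<in>{i, j}. X l \<omega>)"
        by (rule indep_vars_integrable[OF _ sub]) (use int ij in auto)
      moreover have "expectation (\<lambda>\<omega>. \<Prod>l\<in>{i, j}. X l \<omega>) = (\<Prod>l\<in>{i, j}. expectation (X l))"
        by (rule indep_vars_lebesgue_integral[OF _ sub]) (use int ij in auto)
      ultimately show ?thesis
        using that mean ij by simp
    qed
    then show "integrable M (\<lambda>\<omega>. X i \<omega> * X j \<omega>)"
      "expectation (\<lambda>\<omega>. X i \<omega> * X j \<omega>) = (if i = j then expectation (\<lambda>\<omega>. (X i \<omega>)\<^sup>2) else 0)"
      using int2[OF ij(1)] by (cases "i = j"; simp add: power2_eq_square)+
  qed
  have square: "(\<Sum>i\<in>I. X i \<omega>)\<^sup>2 = (\<Sum>i\<in>I. \<Sum>j\<in>I. X i \<omega> * X j \<omega>)" for \<omega>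
    by (simp add: power2_eq_square sum_product)
  show "integrable M (\<lambda>\<omega>. (\<Sum>i\<in>I. X i \<omega>)\<^sup>2)"
    unfolding square using prod(1) by (intro Bochner_Integration.integrable_sum) auto
  show "expectation (\<lambda>\<omega>. (\<Sum>i\<in>I. X i \<omega>)\<^sup>2) = (\<Sum>i\<in>I. expectation (\<lambda>\<omega>. (X i \<omega>)\<^sup>2))"
    unfolding square using prod fin
    by (simp add: Bochner_Integration.integral_sum Bochner_Integration.integrable_sum)
qed

text \<open>Sum and integral of non-negative functions commute, so the series of squares has finite
  expectation. It therefore converges almost surely, and its terms tend to zero. Nothing is assumed
  about the joint law of different \<open>W n\<close>.\<close>

lemma (in prob_space) AE_tendsto_0_if_summable_second_moments:
  fixes W :: "nat \<Rightarrow> 'a \<Rightarrow> real"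
  assumes meas: "\<And>n. W n \<in> borel_measurable M"
    and int: "\<And>n. integrable M (\<lambda>\<omega>. (W n \<omega>)\<^sup>2)"
    and summ: "summable (\<lambda>n. expectation (\<lambda>\<omega>. (W n \<omega>)\<^sup>2))"
  shows "AE \<omega> in M. (\<lambda>n. W n \<omega>) \<longlonglongrightarrow> 0"
proof -
  note [measurable] = meas
  have "(\<integral>\<^sup>+\<omega>. (\<Sum>n. ennreal ((W n \<omega>)\<^sup>2)) \<partial>M) = (\<Sum>n. \<integral>\<^sup>+\<omega>. ennreal ((W n \<omega>)\<^sup>2) \<partial>M)"
    by (rule nn_integral_suminf) measurable
  also have "\<dots> = (\<Sum>n. ennreal (expectation (\<lambda>\<omega>. (W n \<omega>)\<^sup>2)))"
    using int by (simp add: nn_integral_eq_integral)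
  also have "\<dots> \<noteq> \<infinity>"
    by (simp add: suminf_ennreal2 summ)
  finally have fin: "(\<integral>\<^sup>+\<omega>. (\<Sum>n. ennreal ((W n \<omega>)\<^sup>2)) \<partial>M) \<noteq> \<infinity>" .
  have "AE \<omega> in M. (\<Sum>n. ennreal ((W n \<omega>)\<^sup>2)) \<noteq> \<infinity>"
    by (rule nn_integral_PInf_AE[OF _ fin]) measurable
  then show ?thesis
  proof eventually_elim
    case (elim \<omega>)
    then have "summable (\<lambda>n. (W n \<omega>)\<^sup>2)"
      by (intro summable_suminf_not_top) auto
    then have "(\<lambda>n. (W n \<omega>)\<^sup>2) \<longlonglongrightarrow> 0"
      by (rule summable_LIMSEQ_zero)
    then have "(\<lambda>n. sqrt ((W n \<omega>)\<^sup>2)) \<longlonglongrightarrow> sqrt 0"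
      by (rule tendsto_real_sqrt)
    then show ?case
      by (simp add: tendsto_rabs_zero_iff)
  qed
qed

text \<open>The second and fourth Gaussian moments are \<open>s^2\<close> and
  \<open>3 * s^4\<close>. The results are kept in powers of the variance because \<open>s\<close>
  will be instantiated with a square root.\<close>

lemma (in prob_space) centred_normal_square_moments:
  assumes s: "0 < s"
    and X: "distributed M lborel X (\<lambda>x. ennreal (normal_density 0 s x))"
  shows "integrable M (\<lambda>\<omega>. (X \<omega>)\<^sup>2)"
    and "expectation (\<lambda>\<omega>. (X \<omega>)\<^sup>2) = s\<^sup>2"
    and "integrable M (\<lambda>\<omega>. ((X \<omega>)\<^sup>2 - s\<^sup>2)\<^sup>2)"
    and "expectation (\<lambda>\<omega>. ((X \<omega>)\<^sup>2 - s\<^sup>2)\<^sup>2) = 2 * (s\<^sup>2)\<^sup>2"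
proof -
  have m: "integrable M (\<lambda>\<omega>. X \<omega> ^ (2 * l))"
    "expectation (\<lambda>\<omega>. X \<omega> ^ (2 * l)) = fact (2 * l) / ((2 / s\<^sup>2) ^ l * fact l)" for l
  proof -
    have hb: "has_bochner_integral lborel (\<lambda>x. normal_density 0 s x * x ^ (2 * l))
        (fact (2 * l) / ((2 / s\<^sup>2) ^ l * fact l))"
      using normal_moment_even[OF s, of 0 l] by simp
    have meas: "(\<lambda>x::real. x ^ (2 * l)) \<in> borel_measurable lborel"
      by simp
    show "integrable M (\<lambda>\<omega>. X \<omega> ^ (2 * l))"
      using distributed_integrable[OF X meas] hb by (auto intro: integrable.intros)
    show "expectation (\<lambda>\<omega>. X \<omega> ^ (2 * l)) = fact (2 * l) / ((2 / s\<^sup>2) ^ l * fact l)"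
      using distributed_integral[OF X meas] has_bochner_integral_integral_eq[OF hb] by simp
  qed
  show i2: "integrable M (\<lambda>\<omega>. (X \<omega>)\<^sup>2)" and e2: "expectation (\<lambda>\<omega>. (X \<omega>)\<^sup>2) = s\<^sup>2"
    using m[of 1] s by (simp_all add: fact_numeral)
  have i4: "integrable M (\<lambda>\<omega>. X \<omega> ^ 4)" and e4: "expectation (\<lambda>\<omega>. X \<omega> ^ 4) = 3 * (s\<^sup>2)\<^sup>2"
    using m[of 2] s by (simp_all add: fact_numeral power_divide field_simps)
  have expand: "((X \<omega>)\<^sup>2 - s\<^sup>2)\<^sup>2 = X \<omega> ^ 4 - 2 * s\<^sup>2 * (X \<omega>)\<^sup>2 + (s\<^sup>2)\<^sup>2" for \<omega>
    by (simp add: power2_diff power_mult[symmetric] algebra_simps)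
  show "integrable M (\<lambda>\<omega>. ((X \<omega>)\<^sup>2 - s\<^sup>2)\<^sup>2)"
    unfolding expand using i2 i4 by simp
  show "expectation (\<lambda>\<omega>. ((X \<omega>)\<^sup>2 - s\<^sup>2)\<^sup>2) = 2 * (s\<^sup>2)\<^sup>2"
    unfolding expand using i2 i4 e2 e4
    by (simp add: prob_space power2_eq_square)
qed

section \<open>The upper triangle as index set of the free entries\<close>

lemma card_upper_triangle: "2 * card {(i, j). i \<le> j \<and> j < (N::nat)} = N * (N + 1)"
proof -
  have "{(i, j). i \<le> j \<and> j < N} = (\<lambda>(j, i). (i, j)) ` (SIGMA j:{..<N}. {..j})"
    by force
  moreover have "inj_on (\<lambda>(j, i). (i, j)) (SIGMA j:{..<N}. {..j})"
    by (auto simp: inj_on_def)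
  ultimately have "card {(i, j). i \<le> j \<and> j < N} = (\<Sum>j<N. Suc j)"
    by (simp add: card_image)
  moreover have "2 * (\<Sum>j<N. Suc j) = N * (N + 1)"
    by (induction N) auto
  ultimately show ?thesis by simp
qed

lemma finite_upper_triangle: "finite {(i, j). i \<le> j \<and> j < (N::nat)}"
  by (rule finite_subset[of _ "{..<N} \<times> {..<N}"]) auto

lemma sum_symmetric_upper_triangle:
  fixes f :: "nat \<Rightarrow> nat \<Rightarrow> real"
  assumes sym: "\<And>i j. f i j = f j i"
  shows "(\<Sum>i<N. \<Sum>j<N. f i j) =
    (\<Sum>(i, j)\<in>{(i, j). i \<le> j \<and> j < N}. (if i = j then 1 else 2) * f i j)"
proof -
  let ?U = "{(i, j). i \<le> j \<and> j < N}" and ?L = "{(i, j). i \<le> j \<and> j < N} - {(i, j). i = j}"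
  have "p \<in> prod.swap ` ?L" if "p \<in> {(i, j). j < i \<and> i < N}" for p
  proof (rule image_eqI)
    show "p = prod.swap (prod.swap p)" "prod.swap p \<in> ?L"
      using that by auto
  qed
  \<comment> \<open>The full square is the closed upper triangle together with the mirror image of
    the strict one, which is why off-diagonal entries receive weight 2.\<close>
  then have split: "{..<N} \<times> {..<N} = ?U \<union> prod.swap ` ?L"
    by force
  have "(\<Sum>i<N. \<Sum>j<N. f i j) = (\<Sum>(i, j)\<in>{..<N} \<times> {..<N}. f i j)"
    by (rule sum.cartesian_product)
  also have "\<dots> = (\<Sum>(i, j)\<in>?U. f i j) + (\<Sum>(i, j)\<in>prod.swap ` ?L. f i j)"
    unfolding split
    by (rule sum.union_disjoint) (auto intro: finite_upper_triangle)
  also have "(\<Sum>(i, j)\<in>prod.swap ` ?L. f i j) = (\<Sum>(i, j)\<in>?L. f i j)"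
    by (subst sum.reindex) (auto intro!: sum.cong simp: sym)
  also have "\<dots> = (\<Sum>(i, j)\<in>?U. if i = j then 0 else f i j)"
    by (rule sum.mono_neutral_cong_left) (auto intro: finite_upper_triangle)
  also have "(\<Sum>(i, j)\<in>?U. f i j) + \<dots> = (\<Sum>(i, j)\<in>?U. (if i = j then 1 else 2) * f i j)"
    unfolding sum.distrib[symmetric] by (rule sum.cong[OF refl]) auto
  finally show ?thesis .
qed

text \<open>Written over the upper triangle, the squared norm is a weighted sum of independent
  squares with mean \<open>N + 1\<close>. After division by \<open>N + 1\<close> the fluctuation has
  second moment of order \<open>1 / N^2\<close>, which is summable.\<close>

lemma (in prob_space) goe_frobenius_norm_limit:
  fixes G :: "nat \<Rightarrow> 'a \<Rightarrow> nat \<Rightarrow> nat \<Rightarrow> real"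
  assumes sym: "\<And>N \<omega> i j. G N \<omega> i j = G N \<omega> j i"
    and indep: "\<And>N. 0 < N \<Longrightarrow>
      indep_vars (\<lambda>_. borel) (\<lambda>(i, j) \<omega>. G N \<omega> i j) {(i, j). i \<le> j \<and> j < N}"
    and offdiag: "\<And>N i j. i < j \<Longrightarrow> j < N \<Longrightarrow>
      distributed M lborel (\<lambda>\<omega>. G N \<omega> i j) (\<lambda>x. ennreal (normal_density 0 (sqrt (1 / real N)) x))"
    and diag: "\<And>N i. i < N \<Longrightarrow>
      distributed M lborel (\<lambda>\<omega>. G N \<omega> i i) (\<lambda>x. ennreal (normal_density 0 (sqrt (2 / real N)) x))"
  shows "AE \<omega> in M. (\<lambda>N. (\<Sum>i<N. \<Sum>j<N. (G N \<omega> i j)\<^sup>2) / (real N + 1)) \<longlonglongrightarrow> 1"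
proof -
  define U where "U N = {(i, j). i \<le> j \<and> j < N}" for N :: nat
  \<comment> \<open>\<open>c\<close> is the multiplicity of an entry in the full square and
    \<open>v\<close> its variance. Since \<open>c p * v N p = 2 / N\<close> both on and off the
    diagonal, all the centred terms \<open>Y N p\<close> share the variance
    \<open>8 / N^2\<close>.\<close>
  define c :: "nat \<times> nat \<Rightarrow> real" where "c p = (if fst p = snd p then 1 else 2)" for p
  define v :: "nat \<Rightarrow> nat \<times> nat \<Rightarrow> real" where "v N p = 2 / (c p * real N)" for N p
  define Y where "Y N p \<omega> = c p * ((G N \<omega> (fst p) (snd p))\<^sup>2 - v N p)" for N p \<omega>
  define W where "W N \<omega> = (\<Sum>p\<in>U N. Y N p \<omega>) / (real N + 1)" for N \<omega>
  have finU: "finite (U N)" for N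
    unfolding U_def by (rule finite_upper_triangle)
  have cardU: "real (card (U N)) = real N * (real N + 1) / 2" for N
    using arg_cong[OF card_upper_triangle[of N], of real] unfolding U_def by (simp add: algebra_simps)
  have normal: "distributed M lborel (\<lambda>\<omega>. G N \<omega> (fst p) (snd p))
      (\<lambda>x. ennreal (normal_density 0 (sqrt (v N p)) x))" and v_pos: "0 < v N p"
    if "p \<in> U N" for N p
    using that diag[of "fst p" N] offdiag[of "fst p" "snd p" N]
    by (auto simp: U_def v_def c_def split: if_splits)
  note moments = centred_normal_square_moments[OF _ normal]
  have Y_int: "integrable M (Y N p)" and Y_mean: "expectation (Y N p) = 0"
    and Y_int2: "integrable M (\<lambda>\<omega>. (Y N p \<omega>)\<^sup>2)"
    and Y_var: "expectation (\<lambda>\<omega>. (Y N p \<omega>)\<^sup>2) = 8 / (real N)\<^sup>2" if "p \<in> U N" for N p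
  proof -
    \<comment> \<open>The standard deviation here is \<open>sqrt (v N p)\<close>; simplification
      reduces its positivity to that of \<open>v N p\<close>.\<close>
    note mo = moments[OF _ that, simplified, OF v_pos[OF that]]
    have v0: "0 \<le> v N p"
      using v_pos[OF that] by simp
    show "integrable M (Y N p)"
      unfolding Y_def using mo(1) by simp
    show "expectation (Y N p) = 0"
      unfolding Y_def using mo(1,2) v0 by (simp add: prob_space)
    show "integrable M (\<lambda>\<omega>. (Y N p \<omega>)\<^sup>2)"
      unfolding Y_def power_mult_distrib using mo(3) v0 by simp
    have "expectation (\<lambda>\<omega>. (Y N p \<omega>)\<^sup>2) = (c p)\<^sup>2 * (2 * (v N p)\<^sup>2)"
      unfolding Y_def power_mult_distrib using mo(4) v0 by simp
    also have "\<dots> = 8 / (real N)\<^sup>2"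
      by (simp add: v_def c_def power_divide power_mult_distrib)
    finally show "expectation (\<lambda>\<omega>. (Y N p \<omega>)\<^sup>2) = 8 / (real N)\<^sup>2" .
  qed
  have Y_indep: "indep_vars (\<lambda>_. borel) (Y N) (U N)" if "0 < N" for N
  proof -
    have "indep_vars (\<lambda>_. borel) (\<lambda>p \<omega>. c p * (((\<lambda>(i, j) \<omega>. G N \<omega> i j) p \<omega>)\<^sup>2 - v N p)) (U N)"
      unfolding U_def
      by (rule indep_vars_compose2[OF indep[OF that], where Y = "\<lambda>p x. c p * (x\<^sup>2 - v N p)"]) measurable
    then show ?thesis
      by (simp add: Y_def[abs_def] case_prod_beta)
  qed
  have W_sq: "integrable M (\<lambda>\<omega>. (W N \<omega>)\<^sup>2) \<and>
      expectation (\<lambda>\<omega>. (W N \<omega>)\<^sup>2) = 4 / (real N * (real N + 1))" for N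
  \<comment> \<open>At \<open>N = 0\<close> the index set is empty and the right-hand side is 0 by
    the convention for division by zero, so the formula holds for every index of the series.\<close>
  proof (cases "N = 0")
    case True
    then show ?thesis by (simp add: W_def U_def)
  next
    case False
    then have N: "0 < N" by simp
    note sq = expectation_square_sum_indep[OF finU Y_indep[OF N] Y_int Y_int2 Y_mean]
    have "expectation (\<lambda>\<omega>. (W N \<omega>)\<^sup>2) = real (card (U N)) * (8 / (real N)\<^sup>2) / (real N + 1)\<^sup>2"
      using sq Y_var by (simp add: W_def power_divide)
    also have "\<dots> = 4 / (real N * (real N + 1))"
      using N by (simp add: cardU power2_eq_square divide_simps)
    finally show ?thesis
      using sq by (simp add: W_def power_divide)
  qed
  have "AE \<omega> in M. (\<lambda>N. W N \<omega>) \<longlonglongrightarrow> 0"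
  proof (rule AE_tendsto_0_if_summable_second_moments)
    show "W N \<in> borel_measurable M" for N
      unfolding W_def using Y_int by (intro borel_measurable_divide borel_measurable_sum) auto
    show "integrable M (\<lambda>\<omega>. (W N \<omega>)\<^sup>2)" for N
      using W_sq by blast
    have "summable (\<lambda>N. 4 * (1 / (real N)\<^sup>2))"
      using inverse_power_summable[of 2, where 'a = real]
      by (intro summable_mult) (simp add: field_simps)
    then have "summable (\<lambda>N. 4 / (real N * (real N + 1)))"
      by (rule summable_comparison_test'[where N = 1])
        (auto simp: power2_eq_square intro!: divide_left_mono mult_left_mono)
    then show "summable (\<lambda>N. expectation (\<lambda>\<omega>. (W N \<omega>)\<^sup>2))"
      using W_sq by simp
  qed
  then show ?thesis
  proof eventually_elim
    case (elim \<omega>)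
    \<comment> \<open>The subtracted means add up to \<open>N * (N + 1) / 2\<close> copies of
      \<open>2 / N\<close>, that is \<open>N + 1\<close>, so the centring contributes exactly
      1.\<close>
    have "W N \<omega> + 1 = (\<Sum>i<N. \<Sum>j<N. (G N \<omega> i j)\<^sup>2) / (real N + 1)" if N: "0 < N" for N
    proof -
      have "(\<Sum>p\<in>U N. Y N p \<omega>) =
          (\<Sum>p\<in>U N. c p * (G N \<omega> (fst p) (snd p))\<^sup>2) - (\<Sum>p\<in>U N. 2 / real N)"
        unfolding Y_def v_def
        by (subst sum_subtractf[symmetric], intro sum.cong refl) (auto simp: c_def algebra_simps)
      also have "(\<Sum>p\<in>U N. 2 / real N) = real N + 1"
        using N by (simp add: cardU)
      also have "(\<Sum>p\<in>U N. c p * (G N \<omega> (fst p) (snd p))\<^sup>2) = (\<Sum>i<N. \<Sum>j<N. (G N \<omega> i j)\<^sup>2)"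
        using sym by (subst sum_symmetric_upper_triangle)
          (auto simp: U_def c_def case_prod_beta intro!: sum.cong)
      finally show ?thesis
        by (simp add: W_def diff_divide_distrib)
    qed
    then have "\<forall>\<^sub>F N in sequentially.
        W N \<omega> + 1 = (\<Sum>i<N. \<Sum>j<N. (G N \<omega> i j)\<^sup>2) / (real N + 1)"
      by (intro eventually_sequentiallyI[of 1]) auto
    moreover have "(\<lambda>N. W N \<omega> + 1) \<longlonglongrightarrow> 0 + 1"
      by (intro tendsto_intros elim)
    ultimately show ?case
      using tendsto_cong by force
  qed
qed

section \<open>Limits of the scores\<close>

text \<open>After expanding the square, the sum over entries factors into two inner products, and
  orthonormality leaves only \<open>r = s\<close>. The value does not depend on \<open>N\<close>, so
  the spikes vanish after division by \<open>N + 1\<close>.\<close>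

lemma sum_spike_squares:
  fixes u :: "nat \<Rightarrow> nat \<Rightarrow> real"
  assumes orth: "\<And>r s. r < k \<Longrightarrow> s < k \<Longrightarrow> (\<Sum>i<N. u r i * u s i) = (if r = s then 1 else 0)"
  shows "(\<Sum>i<N. \<Sum>j<N. (\<Sum>r<k. lam r * u r i * u r j)\<^sup>2) = (\<Sum>r<k. (lam r)\<^sup>2)"
proof -
  have swap: "(\<Sum>i<N. \<Sum>j<N. \<Sum>r<k. \<Sum>s<k. F i j r s) = (\<Sum>r<k. \<Sum>s<k. \<Sum>i<N. \<Sum>j<N. F i j r s)"
    for F :: "nat \<Rightarrow> nat \<Rightarrow> nat \<Rightarrow> nat \<Rightarrow> real"
  proof -
    have "(\<Sum>i<N. \<Sum>j<N. \<Sum>r<k. \<Sum>s<k. F i j r s) = (\<Sum>i<N. \<Sum>r<k. \<Sum>j<N. \<Sum>s<k. F i j r s)"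
      by (intro sum.cong refl sum.swap)
    also have "\<dots> = (\<Sum>r<k. \<Sum>i<N. \<Sum>s<k. \<Sum>j<N. F i j r s)"
      by (subst sum.swap) (intro sum.cong refl sum.swap)
    also have "\<dots> = (\<Sum>r<k. \<Sum>s<k. \<Sum>i<N. \<Sum>j<N. F i j r s)"
      by (intro sum.cong refl sum.swap)
    finally show ?thesis .
  qed
  have "(\<Sum>i<N. \<Sum>j<N. (\<Sum>r<k. lam r * u r i * u r j)\<^sup>2) =
      (\<Sum>i<N. \<Sum>j<N. \<Sum>r<k. \<Sum>s<k. lam r * lam s * (u r i * u s i) * (u r j * u s j))"
    by (simp add: power2_eq_square sum_product ac_simps)
  also have "\<dots> = (\<Sum>r<k. \<Sum>s<k. \<Sum>i<N. \<Sum>j<N. lam r * lam s * (u r i * u s i) * (u r j * u s j))"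
    by (rule swap)
  also have "\<dots> = (\<Sum>r<k. \<Sum>s<k. lam r * lam s * (\<Sum>i<N. u r i * u s i) * (\<Sum>j<N. u r j * u s j))"
    by (simp only: mult.assoc sum_product) (simp only: sum_distrib_left)
  also have "\<dots> = (\<Sum>r<k. \<Sum>s<k. if r = s then (lam r)\<^sup>2 else 0)"
    using orth by (intro sum.cong refl) (auto simp: power2_eq_square)
  also have "\<dots> = (\<Sum>r<k. (lam r)\<^sup>2)"
    by simp
  finally show ?thesis .
qed

text \<open>Of the three terms of the expanded square, the first is \<open>a / (N + 1)\<close>
  eventually, and Cauchy-Schwarz bounds the cross term by the geometric mean of the other two. The
  condition on \<open>A\<close> is only eventual because \<open>k\<close> orthonormal vectors
  require \<open>k\<close> dimensions.\<close>

lemma perturbed_frobenius_limit: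
  fixes A G :: "nat \<Rightarrow> nat \<Rightarrow> nat \<Rightarrow> real"
  assumes A: "\<forall>\<^sub>F N in sequentially. (\<Sum>i<N. \<Sum>j<N. (A N i j)\<^sup>2) = a"
    and G: "(\<lambda>N. (\<Sum>i<N. \<Sum>j<N. (G N i j)\<^sup>2) / (real N + 1)) \<longlonglongrightarrow> 1"
  shows "(\<lambda>N. (\<Sum>i<N. \<Sum>j<N. (A N i j + \<sigma> * G N i j)\<^sup>2) / (real N + 1)) \<longlonglongrightarrow> \<sigma>\<^sup>2"
proof -
  define SA where "SA N = (\<Sum>i<N. \<Sum>j<N. (A N i j)\<^sup>2) / (real N + 1)" for N
  define SG where "SG N = (\<Sum>i<N. \<Sum>j<N. (G N i j)\<^sup>2) / (real N + 1)" for N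
  define AG where "AG N = (\<Sum>i<N. \<Sum>j<N. A N i j * G N i j) / (real N + 1)" for N
  have "(\<lambda>N. a / (real N + 1)) \<longlonglongrightarrow> 0"
    by real_asymp
  then have SA0: "SA \<longlonglongrightarrow> 0"
    using A unfolding SA_def by (rule_tac tendsto_cong[THEN iffD1]) (auto elim: eventually_mono)
  have SG1: "SG \<longlonglongrightarrow> 1"
    using G by (simp add: SG_def[abs_def])
  have cauchy: "norm (AG N) \<le> sqrt (SA N * SG N)" for N
  proof -
    have "(\<Sum>p\<in>{..<N} \<times> {..<N}. A N (fst p) (snd p) * G N (fst p) (snd p))\<^sup>2 \<le>
        (\<Sum>p\<in>{..<N} \<times> {..<N}. (A N (fst p) (snd p))\<^sup>2) * (\<Sum>p\<in>{..<N} \<times> {..<N}. (G N (fst p) (snd p))\<^sup>2)"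
      by (rule Cauchy_Schwarz_ineq_sum)
    then have "(\<Sum>i<N. \<Sum>j<N. A N i j * G N i j)\<^sup>2 \<le>
        (\<Sum>i<N. \<Sum>j<N. (A N i j)\<^sup>2) * (\<Sum>i<N. \<Sum>j<N. (G N i j)\<^sup>2)"
      by (simp add: sum.cartesian_product case_prod_beta)
    then have "(AG N)\<^sup>2 \<le> SA N * SG N"
      unfolding AG_def SA_def SG_def
      by (simp add: power_divide power2_eq_square[of "real N + 1"] divide_right_mono)
    then show ?thesis
      using real_le_rsqrt[of "\<bar>AG N\<bar>"] by simp
  qed
  have "(\<lambda>N. sqrt (SA N * SG N)) \<longlonglongrightarrow> sqrt (0 * 1)"
    by (intro tendsto_intros SA0 SG1)
  then have AG0: "AG \<longlonglongrightarrow> 0"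
    using cauchy by (intro Lim_null_comparison[of AG "\<lambda>N. sqrt (SA N * SG N)"]) auto
  have "(\<lambda>N. SA N + 2 * \<sigma> * AG N + \<sigma>\<^sup>2 * SG N) \<longlonglongrightarrow> 0 + 2 * \<sigma> * 0 + \<sigma>\<^sup>2 * 1"
    by (intro tendsto_intros SA0 AG0 SG1)
  moreover have "(\<Sum>i<N. \<Sum>j<N. (A N i j + \<sigma> * G N i j)\<^sup>2) / (real N + 1) =
      SA N + 2 * \<sigma> * AG N + \<sigma>\<^sup>2 * SG N" for N
    unfolding SA_def AG_def SG_def
    by (simp add: power2_sum sum.distrib power_mult_distrib sum_distrib_left
        add_divide_distrib mult.assoc mult.left_commute[of _ \<sigma>])
  ultimately show ?thesis by simp
qed

section \<open>Normalised differences of scores\<close>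

lemma param_count_limit:
  "(\<lambda>N. (\<gamma> * (real N * real j - real j * (real j - 1) / 2)
      - \<gamma> * (real N * real m - real m * (real m - 1) / 2)) / real N) \<longlonglongrightarrow> \<gamma> * (real j - real m)"
  unfolding right_diff_distrib by real_asymp

lemma sum_split_atLeastLessThan:
  fixes f :: "nat \<Rightarrow> real"
  assumes "j \<le> m" "m \<le> N"
  shows "(\<Sum>i\<in>{j..<N}. f i) = (\<Sum>i\<in>{j..<m}. f i) + (\<Sum>i\<in>{m..<N}. f i)"
  using sum.atLeastLessThan_concat[OF assms, of f] by simp

text \<open>The model-independent terms and the eigenvalues from index \<open>m\<close> on cancel,
  leaving finitely many convergent ones. Distributing the penalty over the sum gives one term per
  added rank, so signs can be read off term by term.\<close>

lemma gaic_known_diff_limit: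
  fixes ls :: "nat \<Rightarrow> real list"
  assumes jm: "j \<le> m"
    and lim: "\<And>i. i < m \<Longrightarrow> (\<lambda>N. ls N ! i) \<longlonglongrightarrow> L i"
  shows "(\<lambda>N. (gaic_known N \<sigma> \<gamma> (ls N) j - gaic_known N \<sigma> \<gamma> (ls N) m) / real N)
    \<longlonglongrightarrow> (\<Sum>i\<in>{j..<m}. (L i)\<^sup>2 / (2 * \<sigma>\<^sup>2) - \<gamma>)"
proof -
  define T where "T N = (\<Sum>i\<in>{j..<m}. (ls N ! i)\<^sup>2)" for N
  define pen where "pen N = \<gamma> * (real N * real j - real j * (real j - 1) / 2)
      - \<gamma> * (real N * real m - real m * (real m - 1) / 2)" for N
  have "T \<longlonglongrightarrow> (\<Sum>i\<in>{j..<m}. (L i)\<^sup>2)"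
    unfolding T_def using lim by (intro tendsto_intros) auto
  then have "(\<lambda>N. T N * (1 / (2 * \<sigma>\<^sup>2)) + pen N / real N) \<longlonglongrightarrow>
      (\<Sum>i\<in>{j..<m}. (L i)\<^sup>2) * (1 / (2 * \<sigma>\<^sup>2)) + \<gamma> * (real j - real m)"
    unfolding pen_def by (intro tendsto_intros param_count_limit)
  also have "(\<Sum>i\<in>{j..<m}. (L i)\<^sup>2) * (1 / (2 * \<sigma>\<^sup>2)) + \<gamma> * (real j - real m) =
      (\<Sum>i\<in>{j..<m}. (L i)\<^sup>2 / (2 * \<sigma>\<^sup>2) - \<gamma>)"
    using jm by (simp add: sum_subtractf sum_divide_distrib of_nat_diff algebra_simps)
  finally show ?thesis
  proof (rule tendsto_cong[THEN iffD1, rotated])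
    show "\<forall>\<^sub>F N in sequentially. T N * (1 / (2 * \<sigma>\<^sup>2)) + pen N / real N =
        (gaic_known N \<sigma> \<gamma> (ls N) j - gaic_known N \<sigma> \<gamma> (ls N) m) / real N"
      \<comment> \<open>The tail can be split at \<open>m\<close> once \<open>m \<le> N\<close>, and
        division by \<open>N\<close> needs \<open>N\<close> positive.\<close>
      using eventually_ge_at_top[of "max 1 m"]
    proof eventually_elim
      case (elim N)
      then have N: "m \<le> N" "0 < real N" by auto
      have "gaic_known N \<sigma> \<gamma> (ls N) j - gaic_known N \<sigma> \<gamma> (ls N) m = real N / (2 * \<sigma>\<^sup>2) * T N + pen N"
        unfolding gaic_known_def sum_split_atLeastLessThan[OF jm N(1)] T_def pen_def
        by (simp add: distrib_left)
      then show ?case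
        using N(2) by (simp add: add_divide_distrib)
    qed
  qed
qed

text \<open>The estimate differs from the normalised full sum by \<open>j\<close> convergent squares
  divided by \<open>N + 1\<close>.\<close>

lemma sigma_hat_sq_limit:
  fixes ls :: "nat \<Rightarrow> real list"
  assumes lim: "\<And>i. i < j \<Longrightarrow> (\<lambda>N. ls N ! i) \<longlonglongrightarrow> L i"
    and frob: "(\<lambda>N. (\<Sum>i<N. (ls N ! i)\<^sup>2) / (real N + 1)) \<longlonglongrightarrow> \<tau>"
  shows "(\<lambda>N. sigma_hat_sq N (ls N) j) \<longlonglongrightarrow> \<tau>"
proof -
  have "(\<lambda>N. \<Sum>i\<in>{0..<j}. (ls N ! i)\<^sup>2) \<longlonglongrightarrow> (\<Sum>i\<in>{0..<j}. (L i)\<^sup>2)"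
    using lim by (intro tendsto_intros) auto
  moreover have "(\<lambda>N. 1 / (real N + 1)) \<longlonglongrightarrow> 0"
    by real_asymp
  ultimately have "(\<lambda>N. (\<Sum>i<N. (ls N ! i)\<^sup>2) / (real N + 1) -
      (\<Sum>i\<in>{0..<j}. (ls N ! i)\<^sup>2) * (1 / (real N + 1))) \<longlonglongrightarrow> \<tau> - (\<Sum>i\<in>{0..<j}. (L i)\<^sup>2) * 0"
    by (intro tendsto_diff tendsto_mult frob)
  then have "(\<lambda>N. (\<Sum>i<N. (ls N ! i)\<^sup>2) / (real N + 1) -
      (\<Sum>i\<in>{0..<j}. (ls N ! i)\<^sup>2) * (1 / (real N + 1))) \<longlonglongrightarrow> \<tau>"
    by simp
  then show ?thesis
  proof (rule tendsto_cong[THEN iffD1, rotated])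
    show "\<forall>\<^sub>F N in sequentially. (\<Sum>i<N. (ls N ! i)\<^sup>2) / (real N + 1) -
        (\<Sum>i\<in>{0..<j}. (ls N ! i)\<^sup>2) * (1 / (real N + 1)) = sigma_hat_sq N (ls N) j"
      using eventually_ge_at_top[of j]
    proof eventually_elim
      case (elim N)
      show ?case
        using sum_split_atLeastLessThan[of 0 j N "\<lambda>i. (ls N ! i)\<^sup>2"] elim
        by (simp add: sigma_hat_sq_def lessThan_atLeast0 add_divide_distrib)
    qed
  qed
qed

text \<open>The tangent bound for the logarithm; applied with its arguments in both orders it bounds
  a logarithmic difference from both sides.\<close>

lemma ln_diff_le_quotient:
  fixes x y :: real
  assumes "0 < x" "0 < y"
  shows "ln x - ln y \<le> (x - y) / y"
  using ln_le_minus_one[of "x / y"] assms by (simp add: ln_div diff_divide_distrib)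

text \<open>Only the logarithms and the penalty distinguish the models. The two variance estimates
  differ by \<open>T N / (N + 1)\<close>, so the factor \<open>N + 1\<close> in front of the
  logarithms cancels and the limit agrees with the known-variance case.\<close>

lemma gaic_unknown_diff_limit:
  fixes ls :: "nat \<Rightarrow> real list"
  assumes sigma: "0 < \<sigma>" and jm: "j \<le> m"
    and lim: "\<And>i. i < m \<Longrightarrow> (\<lambda>N. ls N ! i) \<longlonglongrightarrow> L i"
    and frob: "(\<lambda>N. (\<Sum>i<N. (ls N ! i)\<^sup>2) / (real N + 1)) \<longlonglongrightarrow> \<sigma>\<^sup>2"
  shows "(\<lambda>N. (gaic_unknown N \<gamma> (ls N) j - gaic_unknown N \<gamma> (ls N) m) / real N)
    \<longlonglongrightarrow> (\<Sum>i\<in>{j..<m}. (L i)\<^sup>2 / (2 * \<sigma>\<^sup>2) - \<gamma>)"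
proof -
  define T where "T N = (\<Sum>i\<in>{j..<m}. (ls N ! i)\<^sup>2)" for N
  define S where "S l N = sigma_hat_sq N (ls N) l" for l N
  define D where "D N = (real N + 1) / 2 * (ln (S j N) - ln (S m N))" for N
  define pen where "pen N = \<gamma> * (real N * real j - real j * (real j - 1) / 2)
      - \<gamma> * (real N * real m - real m * (real m - 1) / 2)" for N
  have T_lim: "T \<longlonglongrightarrow> (\<Sum>i\<in>{j..<m}. (L i)\<^sup>2)"
    unfolding T_def using lim by (intro tendsto_intros) auto
  have S_lim: "S l \<longlonglongrightarrow> \<sigma>\<^sup>2" if "l \<le> m" for l
    unfolding S_def by (rule sigma_hat_sq_limit[OF lim frob]) (use that in auto)
  have S_pos: "\<forall>\<^sub>F N in sequentially. 0 < S l N" if "l \<le> m" for l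
    using order_tendstoD(1)[OF S_lim[OF that], of 0] sigma by simp
  have S_diff: "S j N - S m N = T N / (real N + 1)" if "m \<le> N" for N
    unfolding S_def sigma_hat_sq_def T_def sum_split_atLeastLessThan[OF jm that]
    by (simp add: add_divide_distrib)
  have quot: "(\<lambda>N. T N / (2 * S l N)) \<longlonglongrightarrow> (\<Sum>i\<in>{j..<m}. (L i)\<^sup>2) / (2 * \<sigma>\<^sup>2)" if "l \<le> m" for l
    using sigma by (intro tendsto_intros T_lim S_lim that) simp
  \<comment> \<open>The tangent bound squeezes \<open>D N\<close> between
    \<open>T N / (2 * S j N)\<close> and \<open>T N / (2 * S m N)\<close>; both tend to the same
    limit because both estimates tend to the true variance.\<close>
  have D_lim: "D \<longlonglongrightarrow> (\<Sum>i\<in>{j..<m}. (L i)\<^sup>2) / (2 * \<sigma>\<^sup>2)"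
  proof (rule tendsto_sandwich[OF _ _ quot[OF jm] quot[OF order_refl]])
    show "\<forall>\<^sub>F N in sequentially. T N / (2 * S j N) \<le> D N"
      using S_pos[OF jm] S_pos[OF order_refl] eventually_ge_at_top[of m]
    proof eventually_elim
      case (elim N)
      have "(S j N - S m N) / S j N \<le> ln (S j N) - ln (S m N)"
        using ln_diff_le_quotient[of "S m N" "S j N"] elim by (simp add: diff_divide_distrib)
      then have "(real N + 1) / 2 * ((S j N - S m N) / S j N) \<le> D N"
        unfolding D_def by (intro mult_left_mono) auto
      then show ?case
        by (simp add: S_diff[OF elim(3)])
    qed
    show "\<forall>\<^sub>F N in sequentially. D N \<le> T N / (2 * S m N)"
      using S_pos[OF jm] S_pos[OF order_refl] eventually_ge_at_top[of m]
    proof eventually_elim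
      case (elim N)
      have "D N \<le> (real N + 1) / 2 * ((S j N - S m N) / S m N)"
        unfolding D_def using elim by (intro mult_left_mono ln_diff_le_quotient) auto
      then show ?case
        by (simp add: S_diff[OF elim(3)])
    qed
  qed
  have "(\<lambda>N. D N + pen N / real N) \<longlonglongrightarrow> (\<Sum>i\<in>{j..<m}. (L i)\<^sup>2) / (2 * \<sigma>\<^sup>2) + \<gamma> * (real j - real m)"
    unfolding pen_def by (intro tendsto_intros param_count_limit D_lim)
  also have "(\<Sum>i\<in>{j..<m}. (L i)\<^sup>2) / (2 * \<sigma>\<^sup>2) + \<gamma> * (real j - real m) =
      (\<Sum>i\<in>{j..<m}. (L i)\<^sup>2 / (2 * \<sigma>\<^sup>2) - \<gamma>)"
    using jm by (simp add: sum_subtractf sum_divide_distrib of_nat_diff algebra_simps)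
  finally show ?thesis
  proof (rule tendsto_cong[THEN iffD1, rotated])
    show "\<forall>\<^sub>F N in sequentially. D N + pen N / real N =
        (gaic_unknown N \<gamma> (ls N) j - gaic_unknown N \<gamma> (ls N) m) / real N"
      using S_pos[OF jm] S_pos[OF order_refl] eventually_ge_at_top[of 1]
    proof eventually_elim
      case (elim N)
      \<comment> \<open>At the maximum likelihood estimate the quadratic term does not depend on the model.\<close>
      have quad: "real N / (2 * sigma_hat_sq N (ls N) l) * (\<Sum>i\<in>{l..<N}. (ls N ! i)\<^sup>2) =
          real N * (real N + 1) / 2" if "0 < S l N" for l
      proof -
        have "(\<Sum>i\<in>{l..<N}. (ls N ! i)\<^sup>2) = (real N + 1) * S l N"
          by (simp add: S_def sigma_hat_sq_def)
        then show ?thesis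
          using that by (simp add: S_def)
      qed
      have "gaic_unknown N \<gamma> (ls N) j - gaic_unknown N \<gamma> (ls N) m = real N * D N + pen N"
        unfolding gaic_unknown_def quad[OF elim(1)] quad[OF elim(2)] D_def pen_def S_def
        by (simp add: algebra_simps diff_divide_distrib)
      then show ?case
        using elim(3) by (simp add: add_divide_distrib)
    qed
  qed
qed

section \<open>From score differences to the minimiser\<close>

lemma argmin_upto_minimizes:
  "argmin_upto q f \<le> q" "i \<le> q \<Longrightarrow> f (argmin_upto q f) \<le> f i"
proof -
  obtain j where "j \<le> q" "\<And>i. i \<le> q \<Longrightarrow> f j \<le> f i"
    using ex_min_if_finite[of "f ` {..q}"] by (fastforce simp: not_less)
  then have "\<exists>j. j \<le> q \<and> (\<forall>i\<le>q. f j \<le> f i)" by blast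
  from LeastI_ex[OF this]
  show "argmin_upto q f \<le> q" "i \<le> q \<Longrightarrow> f (argmin_upto q f) \<le> f i"
    unfolding argmin_upto_def by blast+
qed

lemma argmin_upto_ge:
  assumes "k \<le> q" "\<And>j. j < k \<Longrightarrow> f k < f j"
  shows "k \<le> argmin_upto q f"
  using argmin_upto_minimizes[where f = f and q = q] assms by (metis not_less)

lemma argmin_upto_le:
  assumes "k \<le> q" "\<And>j. k < j \<Longrightarrow> j \<le> q \<Longrightarrow> f k < f j"
  shows "argmin_upto q f \<le> k"
  using argmin_upto_minimizes[where f = f and q = q] assms by (metis not_less)

text \<open>Both score types have the same limiting differences, in which index \<open>i\<close>
  contributes with the sign of \<open>(L i)^2 - 2 * \<gamma> * \<sigma>^2\<close>. If the relevant
  terms share a strict sign, rank \<open>k\<close> eventually beats each competitor on that side,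
  and there are finitely many of these.\<close>

lemma khat_limits:
  fixes ls :: "nat \<Rightarrow> real list"
  assumes sigma: "0 < \<sigma>" and kq: "k \<le> q"
    and lim: "\<And>i. i < q \<Longrightarrow> (\<lambda>N. ls N ! i) \<longlonglongrightarrow> L i"
    and frob: "(\<lambda>N. (\<Sum>i<N. (ls N ! i)\<^sup>2) / (real N + 1)) \<longlonglongrightarrow> \<sigma>\<^sup>2"
  shows "(\<And>i. i < k \<Longrightarrow> 2 * \<gamma> * \<sigma>\<^sup>2 < (L i)\<^sup>2) \<Longrightarrow>
      \<forall>\<^sub>F N in sequentially. k \<le> khat known N \<sigma> \<gamma> q (ls N)"
    and "(\<And>i. k \<le> i \<Longrightarrow> i < q \<Longrightarrow> (L i)\<^sup>2 < 2 * \<gamma> * \<sigma>\<^sup>2) \<Longrightarrow>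
      \<forall>\<^sub>F N in sequentially. khat known N \<sigma> \<gamma> q (ls N) \<le> k"
proof -
  define gaic where "gaic N = (if known then gaic_known N \<sigma> \<gamma> (ls N) else gaic_unknown N \<gamma> (ls N))" for N
  have khat: "khat known N \<sigma> \<gamma> q (ls N) = argmin_upto q (gaic N)" for N
    by (simp add: khat_def gaic_def)
  have diff: "(\<lambda>N. (gaic N j - gaic N m) / real N) \<longlonglongrightarrow> (\<Sum>i\<in>{j..<m}. (L i)\<^sup>2 / (2 * \<sigma>\<^sup>2) - \<gamma>)"
    if "j \<le> m" "m \<le> q" for j m
    unfolding gaic_def
    using gaic_known_diff_limit[of j m ls L] gaic_unknown_diff_limit[of \<sigma> j m ls L, OF sigma _ _ frob]
      lim that by (cases known) auto
  {
    assume big: "\<And>i. i < k \<Longrightarrow> 2 * \<gamma> * \<sigma>\<^sup>2 < (L i)\<^sup>2"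
    have "\<forall>\<^sub>F N in sequentially. gaic N k < gaic N j" if "j < k" for j
    proof -
      have "0 < (\<Sum>i\<in>{j..<k}. (L i)\<^sup>2 / (2 * \<sigma>\<^sup>2) - \<gamma>)"
        using that big sigma by (intro sum_pos) (auto simp: field_simps)
      then have "\<forall>\<^sub>F N in sequentially. 0 < (gaic N j - gaic N k) / real N"
        using order_tendstoD(1)[OF diff[of j k]] that kq by simp
      then show ?thesis
        by eventually_elim (auto simp: zero_less_divide_iff)
    qed
    then have "\<forall>\<^sub>F N in sequentially. \<forall>j\<in>{..<k}. gaic N k < gaic N j"
      by (simp add: eventually_ball_finite)
    then show "\<forall>\<^sub>F N in sequentially. k \<le> khat known N \<sigma> \<gamma> q (ls N)"
      unfolding khat by eventually_elim (rule argmin_upto_ge[OF kq], simp)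
  next
    assume small: "\<And>i. k \<le> i \<Longrightarrow> i < q \<Longrightarrow> (L i)\<^sup>2 < 2 * \<gamma> * \<sigma>\<^sup>2"
    have "\<forall>\<^sub>F N in sequentially. gaic N k < gaic N j" if "k < j" "j \<le> q" for j
    proof -
      have "0 < (\<Sum>i\<in>{k..<j}. - ((L i)\<^sup>2 / (2 * \<sigma>\<^sup>2) - \<gamma>))"
        using that small sigma by (intro sum_pos) (auto simp: field_simps)
      then have "(\<Sum>i\<in>{k..<j}. (L i)\<^sup>2 / (2 * \<sigma>\<^sup>2) - \<gamma>) < 0"
        by (simp only: sum_negf)
      then have "\<forall>\<^sub>F N in sequentially. (gaic N k - gaic N j) / real N < 0"
        using order_tendstoD(2)[OF diff[of k j]] that by simp
      then show ?thesis
        by eventually_elim (auto simp: divide_less_0_iff)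
    qed
    then have "\<forall>\<^sub>F N in sequentially. \<forall>j\<in>{k<..q}. gaic N k < gaic N j"
      by (simp add: eventually_ball_finite)
    then show "\<forall>\<^sub>F N in sequentially. khat known N \<sigma> \<gamma> q (ls N) \<le> k"
      unfolding khat by eventually_elim (rule argmin_upto_le[OF kq], simp)
  }
qed

section \<open>The spike map and its inverse above the threshold\<close>

lemma psi_strict_mono:
  assumes "0 < \<sigma>" "\<sigma> \<le> x" "x < y"
  shows "psi \<sigma> x < psi \<sigma> y"
proof -
  \<comment> \<open>This factorisation gives the sign even when \<open>x\<close> is the endpoint
    \<open>\<sigma>\<close>, the case that yields the lower bound \<open>2 * \<sigma>\<close> for
    outlying eigenvalues.\<close>
  have "psi \<sigma> y - psi \<sigma> x = (y - x) * (x * y - \<sigma>\<^sup>2) / (x * y)"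
    using assms by (simp add: psi_def power2_eq_square field_simps)
  moreover have "\<sigma> * \<sigma> < x * y"
    using assms by (intro mult_le_less_imp_less) auto
  ultimately show ?thesis
    using assms by (simp add: power2_eq_square) (smt (verit) divide_pos_pos mult_pos_pos)
qed

lemma psi_gt_two_sigma:
  assumes "0 < \<sigma>" "\<sigma> < x"
  shows "2 * \<sigma> < psi \<sigma> x"
  using psi_strict_mono[of \<sigma> \<sigma> x] assms by (simp add: psi_def power2_eq_square)

lemma psi_inv_gt:
  assumes sigma: "0 < \<sigma>" and y: "2 * \<sigma> < y"
  shows "\<sigma> < psi_inv \<sigma> y" "psi \<sigma> (psi_inv \<sigma> y) = y"
proof -
  \<comment> \<open>The equation \<open>psi \<sigma> x = y\<close> is the quadratic
    \<open>x^2 - y * x + \<sigma>^2 = 0\<close> with discriminant \<open>d^2\<close>; its larger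
    root is the one above \<open>\<sigma>\<close>.\<close>
  define d where "d = sqrt (y\<^sup>2 - 4 * \<sigma>\<^sup>2)"
  define x where "x = (y + d) / 2"
  have "(2 * \<sigma>)\<^sup>2 < y\<^sup>2"
    using assms by (intro power_strict_mono) auto
  then have d: "0 < d" "d\<^sup>2 = y\<^sup>2 - 4 * \<sigma>\<^sup>2"
    by (simp_all add: d_def power_mult_distrib)
  have "\<sigma> < x"
    using d(1) y by (simp add: x_def)
  moreover have "x * x + \<sigma>\<^sup>2 = y * x"
    using d(2) by (simp add: x_def power2_eq_square field_simps)
  then have "psi \<sigma> x = y"
    using \<open>\<sigma> < x\<close> sigma by (simp add: psi_def field_simps)
  ultimately have "\<exists>!x. \<sigma> < x \<and> psi \<sigma> x = y"
    using psi_strict_mono[OF sigma] by (metis less_imp_le less_irrefl linorder_neqE)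
  from theI'[OF this] show "\<sigma> < psi_inv \<sigma> y" "psi \<sigma> (psi_inv \<sigma> y) = y"
    unfolding psi_inv_def by auto
qed

text \<open>For \<open>\<gamma>\<close> above 2 the level
  \<open>sqrt (2 * \<gamma>) * \<sigma>\<close> exceeds \<open>2 * \<sigma>\<close>, so
  \<open>psi_inv\<close> is a genuine inverse there. Monotonicity carries the bound on the spike
  over to its limiting eigenvalue.\<close>

lemma psi_squared_gt_if_lambda_gamma_less:
  assumes sigma: "0 < \<sigma>" and gamma: "2 < \<gamma>" and x: "lambda_gamma \<sigma> \<gamma> < x"
  shows "2 * \<gamma> * \<sigma>\<^sup>2 < (psi \<sigma> x)\<^sup>2"
proof -
  have "2 < sqrt (2 * \<gamma>)"
    using gamma by (intro real_less_rsqrt) simp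
  then have y: "2 * \<sigma> < sqrt (2 * \<gamma>) * \<sigma>"
    using sigma by simp
  have "sqrt (2 * \<gamma>) * \<sigma> < psi \<sigma> x"
    using psi_strict_mono[OF sigma _ x] psi_inv_gt[OF sigma y] by (simp add: lambda_gamma_def)
  then have "(sqrt (2 * \<gamma>) * \<sigma>)\<^sup>2 < (psi \<sigma> x)\<^sup>2"
    using sigma gamma by (intro power_strict_mono) auto
  then show ?thesis
    using gamma by (simp add: power_mult_distrib)
qed

section \<open>Almost sure behaviour of the rank estimator\<close>

theorem theorem2p1:
  fixes M :: "'a measure"
    and \<sigma> \<gamma> :: real
    and k q :: nat
    and lam :: "nat \<Rightarrow> real"
    and u :: "nat \<Rightarrow> nat \<Rightarrow> nat \<Rightarrow> real"
    and G :: "nat \<Rightarrow> 'a \<Rightarrow> nat \<Rightarrow> nat \<Rightarrow> real"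
    and known :: bool
  defines "ell \<equiv> (\<lambda>N \<omega>. ordered_eigs N (spiked_X k lam u \<sigma> G N \<omega>))"
  assumes M: "prob_space M"
    and sigma_pos: "0 < \<sigma>"
    and kq: "k \<le> q"
    and lam_mono: "\<And>i j. i \<le> j \<Longrightarrow> j < k \<Longrightarrow> lam j \<le> lam i"
    and lam_bbp: "\<And>i. i < k \<Longrightarrow> \<sigma> < lam i"
    and u_orth: "\<And>N r s. k \<le> N \<Longrightarrow> r < k \<Longrightarrow> s < k \<Longrightarrow>
                   (\<Sum>i<N. u N r i * u N s i) = (if r = s then 1 else 0)"
    and G_sym: "\<And>N \<omega> i j. G N \<omega> i j = G N \<omega> j i"
    and G_indep: "\<And>N. 0 < N \<Longrightarrow>
                   prob_space.indep_vars M (\<lambda>_. borel) (\<lambda>(i, j) \<omega>. G N \<omega> i j)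
                     {(i, j). i \<le> j \<and> j < N}"
    and G_offdiag: "\<And>N i j. i < j \<Longrightarrow> j < N \<Longrightarrow>
                   distributed M lborel (\<lambda>\<omega>. G N \<omega> i j)
                     (\<lambda>x. ennreal (normal_density 0 (sqrt (1 / real N)) x))"
    and G_diag: "\<And>N i. i < N \<Longrightarrow>
                   distributed M lborel (\<lambda>\<omega>. G N \<omega> i i)
                     (\<lambda>x. ennreal (normal_density 0 (sqrt (2 / real N)) x))"
    and spike_lim: "\<And>i. i < k \<Longrightarrow>
                   AE \<omega> in M. (\<lambda>N. ell N \<omega> ! i) \<longlonglongrightarrow> psi \<sigma> (lam i)"
    and bulk_lim: "\<And>i. k \<le> i \<Longrightarrow> i < q \<Longrightarrow>
                   AE \<omega> in M. (\<lambda>N. ell N \<omega> ! i) \<longlonglongrightarrow> 2 * \<sigma>"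
  shows "(\<gamma> \<le> 2 \<longrightarrow>
            (AE \<omega> in M. ereal (real k) \<le> liminf (\<lambda>N. ereal (real (khat known N \<sigma> \<gamma> q (ell N \<omega>))))))
       \<and> (2 < \<gamma> \<longrightarrow>
            (AE \<omega> in M. limsup (\<lambda>N. ereal (real (khat known N \<sigma> \<gamma> q (ell N \<omega>)))) \<le> ereal (real k)))
       \<and> (2 < \<gamma> \<longrightarrow> (0 < k \<longrightarrow> lambda_gamma \<sigma> \<gamma> < lam (k - 1)) \<longrightarrow>
            (AE \<omega> in M. ereal (real k) \<le> liminf (\<lambda>N. ereal (real (khat known N \<sigma> \<gamma> q (ell N \<omega>))))))
       \<and> (2 < \<gamma> \<longrightarrow> (0 < k \<longrightarrow> lambda_gamma \<sigma> \<gamma> < lam (k - 1)) \<longrightarrow>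
            (AE \<omega> in M. (\<lambda>N. real (khat known N \<sigma> \<gamma> q (ell N \<omega>))) \<longlonglongrightarrow> real k))"
proof -
  interpret prob_space M by (rule M)
  define L where "L i = (if i < k then psi \<sigma> (lam i) else 2 * \<sigma>)" for i
  have "AE \<omega> in M. (\<lambda>N. ell N \<omega> ! i) \<longlonglongrightarrow> L i" if "i < q" for i
    using spike_lim[of i] bulk_lim[of i] that by (cases "i < k") (simp_all add: L_def)
  \<comment> \<open>As \<open>q\<close> is fixed, only finitely many exceptional null sets are
    united.\<close>
  then have eigs: "AE \<omega> in M. \<forall>i\<in>{..<q}. (\<lambda>N. ell N \<omega> ! i) \<longlonglongrightarrow> L i"
    by (intro AE_finite_allI) auto
  have "AE \<omega> in M. (\<lambda>N. (\<Sum>i<N. \<Sum>j<N. (G N \<omega> i j)\<^sup>2) / (real N + 1)) \<longlonglongrightarrow> 1"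
    by (rule goe_frobenius_norm_limit[OF G_sym G_indep G_offdiag G_diag])
  then have frob: "AE \<omega> in M. (\<lambda>N. (\<Sum>i<N. (ell N \<omega> ! i)\<^sup>2) / (real N + 1)) \<longlonglongrightarrow> \<sigma>\<^sup>2"
  proof eventually_elim
    case (elim \<omega>)
    have "spiked_X k lam u \<sigma> G N \<omega> i j = spiked_X k lam u \<sigma> G N \<omega> j i" for N i j
      using G_sym[of N \<omega> i j] by (simp add: spiked_X_def ac_simps)
    note eigs_sq = sum_ordered_eigs_squared[OF this]
    have "\<forall>\<^sub>F N in sequentially.
        (\<Sum>i<N. \<Sum>j<N. (\<Sum>r<k. lam r * u N r i * u N r j)\<^sup>2) = (\<Sum>r<k. (lam r)\<^sup>2)"
      using eventually_ge_at_top[of k]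
      by eventually_elim (rule sum_spike_squares[OF u_orth])
    then show ?case
      unfolding ell_def eigs_sq spiked_X_def by (rule perturbed_frobenius_limit[OF _ elim])
  qed
  have lower: "AE \<omega> in M. \<forall>\<^sub>F N in sequentially. k \<le> khat known N \<sigma> \<gamma> q (ell N \<omega>)"
    if big: "\<And>i. i < k \<Longrightarrow> 2 * \<gamma> * \<sigma>\<^sup>2 < (psi \<sigma> (lam i))\<^sup>2"
    using eigs frob
  proof eventually_elim
    case (elim \<omega>)
    show ?case
      by (rule khat_limits(1)[OF sigma_pos kq _ elim(2)]) (use elim(1) big in \<open>auto simp: L_def\<close>)
  qed
  \<comment> \<open>From index \<open>k\<close> on the limits are \<open>2 * \<sigma>\<close>, and
    \<open>4 * \<sigma>^2 < 2 * \<gamma> * \<sigma>^2\<close> amounts to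
    \<open>2 < \<gamma>\<close>.\<close>
  have upper: "AE \<omega> in M. \<forall>\<^sub>F N in sequentially. khat known N \<sigma> \<gamma> q (ell N \<omega>) \<le> k"
    if "2 < \<gamma>"
    using eigs frob
  proof eventually_elim
    case (elim \<omega>)
    show ?case
      by (rule khat_limits(2)[OF sigma_pos kq _ elim(2)])
        (use elim(1) that sigma_pos in \<open>auto simp: L_def power_mult_distrib\<close>)
  qed
  \<comment> \<open>Here the critical level is at most the squared bulk edge, which every spike
    above the BBP threshold strictly exceeds.\<close>
  have small_penalty: "2 * \<gamma> * \<sigma>\<^sup>2 < (psi \<sigma> (lam i))\<^sup>2" if "\<gamma> \<le> 2" "i < k" for i
  proof -
    have "2 * \<gamma> * \<sigma>\<^sup>2 \<le> (2 * \<sigma>)\<^sup>2"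
      using that(1) by (simp add: power_mult_distrib mult_right_mono)
    also have "\<dots> < (psi \<sigma> (lam i))\<^sup>2"
      using psi_gt_two_sigma[OF sigma_pos lam_bbp[OF that(2)]] sigma_pos
      by (intro power_strict_mono) auto
    finally show ?thesis .
  qed
  \<comment> \<open>With indices starting at 0 the weakest spike is \<open>lam (k - 1)\<close>, so
    the condition on it passes to all spikes; for \<open>k = 0\<close> there are none.\<close>
  have large_penalty: "2 * \<gamma> * \<sigma>\<^sup>2 < (psi \<sigma> (lam i))\<^sup>2"
    if "2 < \<gamma>" "0 < k \<longrightarrow> lambda_gamma \<sigma> \<gamma> < lam (k - 1)" "i < k" for i
  proof (rule psi_squared_gt_if_lambda_gamma_less[OF sigma_pos that(1)])
    have "lam (k - 1) \<le> lam i"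
      using that(3) by (intro lam_mono) auto
    then show "lambda_gamma \<sigma> \<gamma> < lam i"
      using that(2,3) by linarith
  qed
  have liminf: "AE \<omega> in M. ereal (real k) \<le> liminf (\<lambda>N. ereal (real (khat known N \<sigma> \<gamma> q (ell N \<omega>))))"
    if "\<And>i. i < k \<Longrightarrow> 2 * \<gamma> * \<sigma>\<^sup>2 < (psi \<sigma> (lam i))\<^sup>2"
  proof -
    have "AE \<omega> in M. \<forall>\<^sub>F N in sequentially. k \<le> khat known N \<sigma> \<gamma> q (ell N \<omega>)"
      by (intro lower that)
    then show ?thesis
      by eventually_elim (auto intro!: Liminf_bounded elim: eventually_mono)
  qed
  show ?thesis
  proof (intro conjI impI)
    assume "\<gamma> \<le> 2"
    then show "AE \<omega> in M. ereal (real k) \<le> liminf (\<lambda>N. ereal (real (khat known N \<sigma> \<gamma> q (ell N \<omega>))))"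
      by (intro liminf small_penalty)
  next
    assume "2 < \<gamma>"
    from upper[OF this]
    show "AE \<omega> in M. limsup (\<lambda>N. ereal (real (khat known N \<sigma> \<gamma> q (ell N \<omega>)))) \<le> ereal (real k)"
      by eventually_elim (auto intro!: Limsup_bounded elim: eventually_mono)
  next
    assume "2 < \<gamma>" "0 < k \<longrightarrow> lambda_gamma \<sigma> \<gamma> < lam (k - 1)"
    then show "AE \<omega> in M. ereal (real k) \<le> liminf (\<lambda>N. ereal (real (khat known N \<sigma> \<gamma> q (ell N \<omega>))))"
      by (intro liminf large_penalty)
  next
    assume gamma: "2 < \<gamma>" "0 < k \<longrightarrow> lambda_gamma \<sigma> \<gamma> < lam (k - 1)"
    have "AE \<omega> in M. \<forall>\<^sub>F N in sequentially. k \<le> khat known N \<sigma> \<gamma> q (ell N \<omega>)"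
      by (intro lower large_penalty gamma)
    with upper[OF gamma(1)]
    show "AE \<omega> in M. (\<lambda>N. real (khat known N \<sigma> \<gamma> q (ell N \<omega>))) \<longlonglongrightarrow> real k"
    proof eventually_elim
      case (elim \<omega>)
      \<comment> \<open>The lower and upper bounds hold eventually on the integers themselves, so
        the estimator is eventually constant, which is more than convergence.\<close>
      then have "\<forall>\<^sub>F N in sequentially. real (khat known N \<sigma> \<gamma> q (ell N \<omega>)) = real k"
        by eventually_elim simp
      then show ?case
        by (rule tendsto_eventually)
    qed
  qed
qed

end
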